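(* Let $n$ be a positive integer and let $p$ be an odd positive integer such that $p<\frac{2(2n-1)}{\pi}$. Let $\Gamma(\tfrac1{2n})=\bigl\{\sum_{k=0}^{N} a_k (2n)^k : N\ge 0,\ a_k\in\{0,\tfrac n2\}\bigr\}$ and $p\,\Gamma(\tfrac{1}{2n})=\{p\gamma:\gamma\in\Gamma(\tfrac1{2n})\}$. Then $\bigl(\mu_{\frac1{2n}},\,p\,\Gamma(\tfrac1{2n})\bigr)$ is a spectral pair, i.e. the set of exponential functions $\{x\mapsto e^{2\pi i s x}: s\in p\,\Gamma(\tfrac1{2n})\}$ is an orthonormal basis for $L^2(\mu_{\frac1{2n}})$.
   Context: For $\lambda\in(0,1)$, the Bernoulli measure $\mu_\lambda$ is the Borel probability measure on $\mathbb{R}$ that is the distribution of the random variable $\sum_{k=1}^\infty \omega_k\lambda^k$, where the $\omega_k$ are independent and take the values $\pm1$ with probability $\tfrac12$ each. Equivalently, it is the unique Borel probability measure with compact support satisfying $\mu_\lambda=\tfrac12(\mu_\lambda\circ\tau_+^{-1}+\mu_\lambda\circ\tau_-^{-1})$, where $\tau_\pm(x)=\lambda(x\pm1)$. Its Fourier transform is $\widehat\mu_\lambda(t)=\int e^{2\pi i x t}\,d\mu_\lambda(x)=\prod_{k=1}^\infty\cos(2\pi\lambda^k t)$. *)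

theory Defs
  imports "HOL-Probability.Probability"
begin

definition rademacher_space :: "(nat \<Rightarrow> real) measure" where
  "rademacher_space = PiM UNIV (\<lambda>_. measure_pmf (pmf_of_set {-1, 1}))"

text \<open>The signs are indexed from 0, so \<open>\<omega> k\<close> is the coefficient of the power \<open>Suc k\<close>.
  The series converges when \<open>\<bar>l\<bar> < 1\<close>.\<close>

definition bernoulli_measure :: "real \<Rightarrow> real measure" where
  "bernoulli_measure l = distr rademacher_space borel (\<lambda>\<omega>. \<Sum>k. \<omega> k * l ^ Suc k)"

lemma sets_bernoulli_measure [simp]: "sets (bernoulli_measure l) = sets borel"
  and space_bernoulli_measure [simp]: "space (bernoulli_measure l) = UNIV"
  by (simp_all add: bernoulli_measure_def)

lemma prob_space_rademacher_space: "prob_space rademacher_space"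
  unfolding rademacher_space_def
  by (intro prob_space_PiM prob_space_measure_pmf)

lemma measurable_rademacher_series:
  "(\<lambda>\<omega>. \<Sum>k. \<omega> k * l ^ Suc k) \<in> borel_measurable rademacher_space"
proof -
  have "(\<lambda>\<omega>. \<omega> k) \<in> borel_measurable rademacher_space" for k
    unfolding rademacher_space_def
    by (rule measurable_compose[OF measurable_component_singleton]) auto
  then show ?thesis
    by (intro borel_measurable_suminf borel_measurable_times) auto
qed

lemma prob_space_bernoulli_measure: "prob_space (bernoulli_measure l)"
  unfolding bernoulli_measure_def
  by (intro prob_space.prob_space_distr prob_space_rademacher_space measurable_rademacher_series)

text \<open>Elements of \<open>L\<^sup>2(M)\<close> are represented by square-integrable functions, without passing to
  classes modulo almost-everywhere equality.\<close>

definition L2 :: "'a measure \<Rightarrow> ('a \<Rightarrow> complex) set" where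
  "L2 M = {f \<in> borel_measurable M. integrable M (\<lambda>x. (norm (f x))\<^sup>2)}"

definition L2_inner :: "'a measure \<Rightarrow> ('a \<Rightarrow> complex) \<Rightarrow> ('a \<Rightarrow> complex) \<Rightarrow> complex" where
  "L2_inner M f g = (LINT x|M. f x * cnj (g x))"

definition L2_norm :: "'a measure \<Rightarrow> ('a \<Rightarrow> complex) \<Rightarrow> real" where
  "L2_norm M f = sqrt (LINT x|M. (norm (f x))\<^sup>2)"

definition orthonormal_L2 :: "'a measure \<Rightarrow> ('a \<Rightarrow> complex) set \<Rightarrow> bool" where
  "orthonormal_L2 M B \<longleftrightarrow>
     B \<subseteq> L2 M \<and> (\<forall>f\<in>B. \<forall>g\<in>B. L2_inner M f g = (if f = g then 1 else 0))"

text \<open>An orthonormal basis in the Hilbert space sense: an orthonormal set whose finite complex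
  linear combinations are dense. The \<open>if f = g\<close> above refers to equality of functions,
  so an orthonormal set contains no two distinct functions that agree almost everywhere.\<close>

definition orthonormal_basis_L2 :: "'a measure \<Rightarrow> ('a \<Rightarrow> complex) set \<Rightarrow> bool" where
  "orthonormal_basis_L2 M B \<longleftrightarrow>
     orthonormal_L2 M B \<and>
     (\<forall>f\<in>L2 M. \<forall>\<epsilon>>0. \<exists>F c. finite F \<and> F \<subseteq> B \<and>
        L2_norm M (\<lambda>x. f x - (\<Sum>g\<in>F. c g * g x)) < \<epsilon>)"

definition expo :: "real \<Rightarrow> real \<Rightarrow> complex" where
  "expo s = (\<lambda>x. exp (2 * of_real pi * \<i> * of_real s * of_real x))"

definition spectral_pair :: "real measure \<Rightarrow> real set \<Rightarrow> bool" where
  "spectral_pair M S \<longleftrightarrow> orthonormal_basis_L2 M (expo ` S)"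

text \<open>\<open>Gamma_set n\<close> is \<open>\<Gamma>(1/(2n))\<close>; the digit \<open>n/2\<close> is a real number, as \<open>n\<close> may be odd.\<close>

definition Gamma_set :: "nat \<Rightarrow> real set" where
  "Gamma_set n =
     {\<Sum>k=0..N. a k * (2 * real n) ^ k | N a. \<forall>k\<le>N. a k \<in> {0, real n / 2}}"

end

theory Submission
  imports Defs
begin

text \<open>
  Put \<open>l = 1 / (2 * n)\<close>. For \<open>\<Gamma>\<^sub>N\<close>, the frequencies with digits below position \<open>N\<close>, the truncated
  transform \<open>P\<^sub>N\<close>, a product of \<open>N\<close> cosines, satisfies \<open>\<Sum>\<gamma>\<in>\<Gamma>\<^sub>N. P\<^sub>N(t - \<gamma>)\<^sup>2 = 1\<close> exactly. The full
  transform is \<open>P(t - \<gamma>) = P\<^sub>N(t - \<gamma>) P(l\<^sup>N (t - \<gamma>))\<close>, and the bound on \<open>p\<close> keeps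
  \<open>l\<^sup>N (t - \<gamma>)\<close> in a compact interval around zero on which \<open>P\<close> is bounded below, for all large \<open>N\<close> and all
  \<open>\<gamma> \<in> \<Gamma>\<^sub>N\<close>. Hence \<open>P\<^sub>N(t - \<gamma>)\<^sup>2\<close> is dominated by a constant multiple of the summable \<open>P(t - \<gamma>)\<^sup>2\<close>,
  and \<open>N \<rightarrow> \<infinity>\<close> gives Parseval's identity for every exponential \<open>expo t\<close>. The exponentials span
  a dense subspace of \<open>L\<^sup>2\<close>.
\<close>

subsection \<open>The Fourier transform of a Bernoulli measure\<close>

lemma expo_0 [simp]: "expo 0 x = 1" "expo s 0 = 1"
  by (simp_all add: expo_def)

lemma expo_add: "expo (s + t) x = expo s x * expo t x"
  by (simp add: expo_def exp_add[symmetric] algebra_simps)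

lemma expo_add_right: "expo s (x + y) = expo s x * expo s y"
  by (simp add: expo_def exp_add[symmetric] algebra_simps)

lemma cnj_expo: "cnj (expo s x) = expo (- s) x"
  by (simp add: expo_def exp_cnj)

lemma norm_expo [simp]: "norm (expo s x) = 1"
  by (simp add: expo_def)

lemma expo_mult_cnj: "expo s x * cnj (expo t x) = expo (s - t) x"
  using expo_add[of s "- t" x] by (simp add: cnj_expo)

lemma borel_measurable_expo [measurable]: "expo s \<in> borel_measurable borel"
  unfolding expo_def by (intro borel_measurable_continuous_onI continuous_intros)

lemma tendsto_expo: "(f \<longlongrightarrow> x) F \<Longrightarrow> ((\<lambda>i. expo s (f i)) \<longlongrightarrow> expo s x) F"
  unfolding expo_def by (intro tendsto_intros)

lemma expo_sum: "finite A \<Longrightarrow> expo s (\<Sum>k\<in>A. f k) = (\<Prod>k\<in>A. expo s (f k))"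
  by (induction A rule: finite_induct) (auto simp: expo_add_right)

lemma expo_sym: "(expo s a + expo s (- a)) / 2 = of_real (cos (2 * pi * s * a))"
  by (simp add: expo_def cos_exp_eq cos_of_real[symmetric] algebra_simps)

section \<open>Random signs and the infinite cosine product\<close>

lemma AE_rademacher_space: "AE \<omega> in rademacher_space. \<forall>k. \<bar>\<omega> k\<bar> = 1"
proof -
  have "AE \<omega> in rademacher_space. \<bar>\<omega> k\<bar> = 1" for k
    unfolding rademacher_space_def
    by (intro AE_PiM_component prob_space_measure_pmf) (auto simp: AE_measure_pmf_iff set_pmf_of_set)
  then show ?thesis by (simp add: AE_all_countable)
qed

lemma measurable_rademacher_coordinate [measurable]:
  "(\<lambda>\<omega>. \<omega> k) \<in> borel_measurable rademacher_space"
  unfolding rademacher_space_def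
  by (rule measurable_compose[OF measurable_component_singleton]) auto

lemma summable_signed_power:
  fixes l :: real
  assumes "\<bar>l\<bar> < 1" "\<forall>k. \<bar>\<omega> k\<bar> = 1"
  shows "summable (\<lambda>k. \<omega> k * l ^ Suc k)"
proof -
  have "summable (\<lambda>k. \<bar>l\<bar> * \<bar>l\<bar> ^ k)"
    by (intro summable_mult summable_geometric) (use assms in auto)
  then show ?thesis
    by (rule summable_comparison_test'[where N=0]) (use assms in \<open>auto simp: abs_mult power_abs\<close>)
qed

definition cos_prod :: "real \<Rightarrow> nat \<Rightarrow> real \<Rightarrow> real" where
  "cos_prod l N s = (\<Prod>k<N. cos (2 * pi * s * l ^ Suc k))"

text \<open>Only finitely many coordinates enter, so the integral moves to a finite product space.
  Independence factors it there, and averaging over the two signs leaves one cosine per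
  coordinate.\<close>

lemma integral_rademacher_expo:
  "(LINT \<omega>|rademacher_space. expo s (\<Sum>k<N. \<omega> k * l ^ Suc k)) = of_real (cos_prod l N s)"
proof -
  let ?M = "\<lambda>_::nat. measure_pmf (pmf_of_set {-1, 1::real})"
  interpret product_prob_space ?M UNIV
    by standard
  let ?f = "\<lambda>k x. expo s (x * l ^ Suc k)"
  have fin: "(LINT x|measure_pmf (pmf_of_set {-1, 1::real}). ?f k x) = of_real (cos (2 * pi * s * l ^ Suc k))" for k
    using expo_sym[of s "l ^ Suc k"]
    by (subst integral_measure_pmf[of "{-1,1}"]) (auto simp: set_pmf_of_set scaleR_conv_of_real algebra_simps add_divide_distrib)
  have "(LINT \<omega>|rademacher_space. expo s (\<Sum>k<N. \<omega> k * l ^ Suc k))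
     = (LINT \<omega>|PiM UNIV ?M. (\<Prod>k<N. ?f k (restrict \<omega> {..<N} k)))"
    by (simp add: rademacher_space_def expo_sum)
  also have "\<dots> = (LINT \<omega>|distr (PiM UNIV ?M) (PiM {..<N} ?M) (\<lambda>\<omega>. restrict \<omega> {..<N}). (\<Prod>k<N. ?f k (\<omega> k)))"
    by (subst integral_distr) (auto intro!: measurable_restrict borel_measurable_prod
        measurable_compose[OF measurable_component_singleton])
  also have "\<dots> = (LINT \<omega>|PiM {..<N} ?M. (\<Prod>k<N. ?f k (\<omega> k)))"
    by (subst distr_PiM_restrict_finite) auto
  also have "\<dots> = (\<Prod>k<N. (LINT x|measure_pmf (pmf_of_set {-1, 1::real}). ?f k x))"
    by (rule product_integral_prod) (auto intro!: integrable_measure_pmf_finite simp: set_pmf_of_set)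
  also have "\<dots> = of_real (cos_prod l N s)"
    by (simp only: fin cos_prod_def of_real_prod)
  finally show ?thesis .
qed

text \<open>The infinite cosine product as a real number. The value of \<open>lim\<close> is
  meaningful only where the partial products converge, which the next lemma supplies for
  \<open>\<bar>l\<bar> < 1\<close>.\<close>

definition bernoulli_ft :: "real \<Rightarrow> real \<Rightarrow> real" where
  "bernoulli_ft l s = lim (\<lambda>N. cos_prod l N s)"

text \<open>Dominated convergence along the partial sums of the random series gives both claims at
  once: the integrals of the truncations are the partial products, so these converge, and their
  limit is the integral.\<close>

lemma
  assumes l: "\<bar>l\<bar> < 1"
  shows tendsto_cos_prod: "(\<lambda>N. cos_prod l N s) \<longlonglongrightarrow> bernoulli_ft l s"
    and integral_bernoulli_expo: "(LINT x|bernoulli_measure l. expo s x) = of_real (bernoulli_ft l s)"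
proof -
  interpret prob_space rademacher_space by (rule prob_space_rademacher_space)
  let ?I = "LINT x|bernoulli_measure l. expo s x"
  have "(\<lambda>N. LINT \<omega>|rademacher_space. expo s (\<Sum>k<N. \<omega> k * l ^ Suc k)) \<longlonglongrightarrow>
        (LINT \<omega>|rademacher_space. expo s (\<Sum>k. \<omega> k * l ^ Suc k))"
  proof (rule integral_dominated_convergence[where w="\<lambda>_. 1"])
    show "(\<lambda>\<omega>. expo s (\<Sum>k. \<omega> k * l ^ Suc k)) \<in> borel_measurable rademacher_space"
      by (rule measurable_compose[OF measurable_rademacher_series borel_measurable_expo])
    show "AE \<omega> in rademacher_space. (\<lambda>N. expo s (\<Sum>k<N. \<omega> k * l ^ Suc k)) \<longlonglongrightarrow> expo s (\<Sum>k. \<omega> k * l ^ Suc k)"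
      using AE_rademacher_space
      by eventually_elim (intro tendsto_expo summable_LIMSEQ summable_signed_power l)
  qed auto
  also have "(LINT \<omega>|rademacher_space. expo s (\<Sum>k. \<omega> k * l ^ Suc k)) = ?I"
    unfolding bernoulli_measure_def
    by (rule integral_distr[symmetric]) (auto intro: measurable_rademacher_series)
  finally have "(\<lambda>N. complex_of_real (cos_prod l N s)) \<longlonglongrightarrow> ?I"
    by (simp only: integral_rademacher_expo)
  then have "(\<lambda>N. cos_prod l N s) \<longlonglongrightarrow> Re ?I" "?I = of_real (Re ?I)"
    by (auto dest: tendsto_Re tendsto_Im simp: complex_eq_iff LIMSEQ_const_iff)
  then show "(\<lambda>N. cos_prod l N s) \<longlonglongrightarrow> bernoulli_ft l s" "?I = of_real (bernoulli_ft l s)"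
    by (simp_all add: bernoulli_ft_def limI)
qed

lemma cos_prod_add: "cos_prod l (N + M) s = cos_prod l N s * cos_prod l M (l ^ N * s)"
  by (induction M) (auto simp: cos_prod_def power_add algebra_simps)

text \<open>Behind the first \<open>N\<close> factors stands a product of the same form with
  rescaled argument. This makes a bound near zero usable at large frequencies.\<close>

lemma bernoulli_ft_split:
  assumes "\<bar>l\<bar> < 1"
  shows "bernoulli_ft l s = cos_prod l N s * bernoulli_ft l (l ^ N * s)"
proof (rule LIMSEQ_unique)
  show "(\<lambda>M. cos_prod l (M + N) s) \<longlonglongrightarrow> bernoulli_ft l s"
    using tendsto_cos_prod[OF assms] by (rule LIMSEQ_ignore_initial_segment)
  show "(\<lambda>M. cos_prod l (M + N) s) \<longlonglongrightarrow> cos_prod l N s * bernoulli_ft l (l ^ N * s)"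
    by (subst add.commute, subst cos_prod_add) (intro tendsto_intros tendsto_cos_prod assms)
qed

section \<open>Support of the measure and size of the transform near zero\<close>

lemma AE_bernoulli_measure_bounded:
  assumes "0 < l" "l \<le> 1 / 2"
  shows "AE x in bernoulli_measure l. \<bar>x\<bar> \<le> 1"
proof -
  have "\<bar>\<Sum>k. \<omega> k * l ^ Suc k\<bar> \<le> 1" if "\<forall>k. \<bar>\<omega> k\<bar> = 1" for \<omega>
  proof -
    have "\<bar>\<Sum>k. \<omega> k * l ^ Suc k\<bar> \<le> (\<Sum>k. l * l ^ k)"
      using assms that
      by (intro order.trans[OF summable_rabs] suminf_le summable_mult summable_geometric)
         (auto simp: abs_mult intro!: summable_comparison_test'[OF summable_mult[OF summable_geometric]])
    also have "\<dots> = l * (1 / (1 - l))"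
      using assms by (subst suminf_mult) (auto simp: suminf_geometric)
    also have "\<dots> \<le> 1" using assms by (simp add: field_simps)
    finally show ?thesis .
  qed
  with AE_rademacher_space have "AE \<omega> in rademacher_space. \<bar>\<Sum>k. \<omega> k * l ^ Suc k\<bar> \<le> 1"
    by (auto elim!: eventually_mono)
  then show ?thesis
    unfolding bernoulli_measure_def
    by (subst AE_distr_iff) (auto intro: measurable_rademacher_series)
qed

lemma cos_ge: "1 - x\<^sup>2 / 2 \<le> cos (x::real)"
proof -
  have "(sin (x / 2))\<^sup>2 \<le> (x / 2)\<^sup>2"
    using abs_sin_x_le_abs_x[of "x/2"] by (metis abs_le_square_iff)
  then show ?thesis
    using cos_double_sin[of "x/2"] by (simp add: power_divide)
qed

text \<open>The hypothesis on \<open>s\<close> bounds the angle of the first factor by 1, and every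
  further angle shrinks by a factor of at least 4. By \<open>cos_ge\<close> the factor of index
  \<open>k\<close> is at least \<open>1 - (1 / 16) ^ k / 2\<close>, and Weierstrass' product
  inequality leaves 1 - 8/15.\<close>

lemma bernoulli_ft_lower_bound:
  assumes l: "0 < l" "l \<le> 1 / 4" and s: "2 * pi * \<bar>s\<bar> * l \<le> 1"
  shows "7 / 15 \<le> bernoulli_ft l s"
proof (rule LIMSEQ_le_const[OF tendsto_cos_prod])
  have "7 / 15 \<le> cos_prod l N s" for N
  proof -
    have sq: "(2 * pi * s * l ^ Suc k)\<^sup>2 \<le> (1 / 16) ^ k" for k
    proof -
      have "\<bar>2 * pi * s * l ^ Suc k\<bar> = (2 * pi * \<bar>s\<bar> * l) * l ^ k"
        using l by (simp add: abs_mult)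
      also have "\<dots> \<le> 1 * (1 / 4) ^ k"
        using l s by (intro mult_mono power_mono) auto
      finally have "\<bar>2 * pi * s * l ^ Suc k\<bar>\<^sup>2 \<le> ((1 / 4) ^ k)\<^sup>2"
        by (intro power_mono) auto
      then show ?thesis
        by (simp only: power2_abs power2_eq_square power_mult_distrib[symmetric]) simp
    qed
    have "(\<Sum>k<N. (1 / 16 :: real) ^ k) \<le> 16 / 15"
      by (simp add: sum_gp_strict)
    then have "7 / 15 \<le> 1 - (\<Sum>k<N. (1 / 16 :: real) ^ k / 2)"
      by (simp add: sum_divide_distrib[symmetric])
    also have "\<dots> \<le> (\<Prod>k<N. 1 - (1 / 16 :: real) ^ k / 2)"
      by (rule Weierstrass_prod_ineq) (auto simp: power_le_one intro: order.trans[of _ 1])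
    also have "\<dots> \<le> cos_prod l N s"
      unfolding cos_prod_def
    proof (rule prod_mono)
      fix k
      show "0 \<le> 1 - (1 / 16 :: real) ^ k / 2 \<and> 1 - (1 / 16) ^ k / 2 \<le> cos (2 * pi * s * l ^ Suc k)"
        using cos_ge[of "2 * pi * s * l ^ Suc k"] sq[of k] power_le_one[of "1/16::real" k] by auto
    qed
    finally show ?thesis .
  qed
  then show "\<exists>N. \<forall>n\<ge>N. 7 / 15 \<le> cos_prod l n s" by blast
qed (use l in auto)

subsection \<open>Closed spans in square-integrable functions\<close>

text \<open>Mean-square distances are used instead of \<^const>\<open>L2_norm\<close>, so that Minkowski's
  inequality is not needed.\<close>

definition L2_closed_span :: "'a measure \<Rightarrow> ('a \<Rightarrow> complex) set \<Rightarrow> ('a \<Rightarrow> complex) set" where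
  "L2_closed_span M B = {f \<in> L2 M. \<forall>\<epsilon>>0. \<exists>F c. finite F \<and> F \<subseteq> B \<and>
     (LINT x|M. (norm (f x - (\<Sum>g\<in>F. c g * g x)))\<^sup>2) < \<epsilon>}"

lemma norm_add_power2_le:
  fixes a b :: "'a :: real_normed_vector"
  shows "(norm (a + b))\<^sup>2 \<le> 2 * (norm a)\<^sup>2 + 2 * (norm b)\<^sup>2"
proof -
  have "(norm (a + b))\<^sup>2 \<le> (norm a + norm b)\<^sup>2"
    by (intro power_mono norm_triangle_ineq) auto
  also have "\<dots> \<le> 2 * (norm a)\<^sup>2 + 2 * (norm b)\<^sup>2"
    using sum_squares_ge_zero[of "norm a - norm b" 0] by (simp add: power2_eq_square algebra_simps)
  finally show ?thesis .
qed

lemma L2_measurable [measurable_dest]: "f \<in> L2 M \<Longrightarrow> f \<in> borel_measurable M"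
  by (simp add: L2_def)

lemma L2_integrable: "f \<in> L2 M \<Longrightarrow> integrable M (\<lambda>x. (norm (f x))\<^sup>2)"
  by (simp add: L2_def)

lemma L2_add:
  assumes "f \<in> L2 M" "g \<in> L2 M"
  shows "(\<lambda>x. f x + g x) \<in> L2 M"
proof -
  note [measurable] = assms[THEN L2_measurable]
  have "integrable M (\<lambda>x. (norm (f x + g x))\<^sup>2)"
    by (rule Bochner_Integration.integrable_bound[where f="\<lambda>x. 2 * (norm (f x))\<^sup>2 + 2 * (norm (g x))\<^sup>2"])
       (use assms in \<open>auto simp: L2_integrable norm_add_power2_le\<close>)
  then show ?thesis by (simp add: L2_def)
qed

lemma L2_cmult: "f \<in> L2 M \<Longrightarrow> (\<lambda>x. c * f x) \<in> L2 M"
  by (auto simp: L2_def norm_mult power_mult_distrib)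

lemma L2_diff: "f \<in> L2 M \<Longrightarrow> g \<in> L2 M \<Longrightarrow> (\<lambda>x. f x - g x) \<in> L2 M"
  using L2_add[of f M "\<lambda>x. (-1) * g x"] L2_cmult[of g M "-1"] by simp

lemma L2_sum: "(\<And>i. i \<in> F \<Longrightarrow> f i \<in> L2 M) \<Longrightarrow> (\<lambda>x. \<Sum>i\<in>F. f i x) \<in> L2 M"
proof (induction F rule: infinite_finite_induct)
  case (insert i F)
  then show ?case using L2_add[of "f i" M "\<lambda>x. \<Sum>i\<in>F. f i x"] by simp
qed (auto simp: L2_def)

lemma L2_lincomb: "F \<subseteq> L2 M \<Longrightarrow> (\<lambda>x. \<Sum>g\<in>F. c g * g x) \<in> L2 M"
  by (intro L2_sum L2_cmult) auto

lemma (in finite_measure) L2_bounded: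
  assumes [measurable]: "f \<in> borel_measurable M" and "AE x in M. norm (f x) \<le> C"
  shows "f \<in> L2 M"
proof -
  have "integrable M (\<lambda>x. (norm (f x))\<^sup>2)"
    by (rule integrable_const_bound[where B="C\<^sup>2"])
       (use assms(2) in \<open>auto elim!: eventually_mono intro!: power_mono\<close>)
  then show ?thesis by (simp add: L2_def)
qed

lemma integral_norm_add_power2_le:
  assumes "f \<in> L2 M" "g \<in> L2 M"
  shows "(LINT x|M. (norm (f x + g x))\<^sup>2) \<le> 2 * (LINT x|M. (norm (f x))\<^sup>2) + 2 * (LINT x|M. (norm (g x))\<^sup>2)"
proof -
  have "(LINT x|M. (norm (f x + g x))\<^sup>2) \<le> (LINT x|M. 2 * (norm (f x))\<^sup>2 + 2 * (norm (g x))\<^sup>2)"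
    using L2_add[OF assms] assms
    by (intro integral_mono Bochner_Integration.integrable_add integrable_mult_right)
       (auto simp: L2_integrable norm_add_power2_le)
  also have "\<dots> = 2 * (LINT x|M. (norm (f x))\<^sup>2) + 2 * (LINT x|M. (norm (g x))\<^sup>2)"
    using assms by (simp add: L2_integrable)
  finally show ?thesis .
qed

lemma L2_closed_span_L2: "f \<in> L2_closed_span M B \<Longrightarrow> f \<in> L2 M"
  by (simp add: L2_closed_span_def)

lemma L2_closed_spanD:
  assumes "f \<in> L2_closed_span M B" "\<epsilon> > 0"
  obtains F c where "finite F" "F \<subseteq> B" "(LINT x|M. (norm (f x - (\<Sum>g\<in>F. c g * g x)))\<^sup>2) < \<epsilon>"
  using assms by (auto simp: L2_closed_span_def)

lemma L2_closed_span_closed: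
  assumes B: "B \<subseteq> L2 M" and f: "f \<in> L2 M"
    and approx: "\<And>\<epsilon>. \<epsilon> > 0 \<Longrightarrow> \<exists>h\<in>L2_closed_span M B. (LINT x|M. (norm (f x - h x))\<^sup>2) < \<epsilon>"
  shows "f \<in> L2_closed_span M B"
proof -
  have "\<exists>F c. finite F \<and> F \<subseteq> B \<and> (LINT x|M. (norm (f x - (\<Sum>g\<in>F. c g * g x)))\<^sup>2) < \<epsilon>" if "\<epsilon> > 0" for \<epsilon>
  proof -
    \<comment> \<open>\<open>integral_norm_add_power2_le\<close> doubles each of the two errors,
      hence the quarters.\<close>
    obtain h where h: "h \<in> L2_closed_span M B" "(LINT x|M. (norm (f x - h x))\<^sup>2) < \<epsilon> / 4"
      using approx[of "\<epsilon> / 4"] \<open>\<epsilon> > 0\<close> by auto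
    obtain F c where F: "finite F" "F \<subseteq> B" "(LINT x|M. (norm (h x - (\<Sum>g\<in>F. c g * g x)))\<^sup>2) < \<epsilon> / 4"
      using L2_closed_spanD[OF h(1), of "\<epsilon> / 4"] \<open>\<epsilon> > 0\<close> by auto
    let ?S = "\<lambda>x. \<Sum>g\<in>F. c g * g x"
    have "?S \<in> L2 M" using F(2) B by (intro L2_lincomb) auto
    then have "(LINT x|M. (norm ((f x - h x) + (h x - ?S x)))\<^sup>2)
       \<le> 2 * (LINT x|M. (norm (f x - h x))\<^sup>2) + 2 * (LINT x|M. (norm (h x - ?S x))\<^sup>2)"
      by (intro integral_norm_add_power2_le L2_diff f L2_closed_span_L2[OF h(1)])
    also have "\<dots> < \<epsilon>" using h(2) F(3) by simp
    finally show ?thesis using F by auto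
  qed
  with f show ?thesis by (simp add: L2_closed_span_def)
qed

lemma L2_closed_span_add:
  assumes B: "B \<subseteq> L2 M" and fg: "f \<in> L2_closed_span M B" "g \<in> L2_closed_span M B"
  shows "(\<lambda>x. f x + g x) \<in> L2_closed_span M B"
proof -
  have "\<exists>F c. finite F \<and> F \<subseteq> B \<and> (LINT x|M. (norm (f x + g x - (\<Sum>h\<in>F. c h * h x)))\<^sup>2) < \<epsilon>" if "\<epsilon> > 0" for \<epsilon>
  proof -
    obtain F c where F: "finite F" "F \<subseteq> B" "(LINT x|M. (norm (f x - (\<Sum>h\<in>F. c h * h x)))\<^sup>2) < \<epsilon> / 4"
      using L2_closed_spanD[OF fg(1), of "\<epsilon> / 4"] \<open>\<epsilon> > 0\<close> by auto
    obtain G d where G: "finite G" "G \<subseteq> B" "(LINT x|M. (norm (g x - (\<Sum>h\<in>G. d h * h x)))\<^sup>2) < \<epsilon> / 4"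
      using L2_closed_spanD[OF fg(2), of "\<epsilon> / 4"] \<open>\<epsilon> > 0\<close> by auto
    \<comment> \<open>Both coefficient functions are extended by 0, so that they add up on the
      overlap of \<open>F\<close> and \<open>G\<close>.\<close>
    define e where "e h = (if h \<in> F then c h else 0) + (if h \<in> G then d h else 0)" for h
    have S: "(\<Sum>h\<in>F \<union> G. e h * h x) = (\<Sum>h\<in>F. c h * h x) + (\<Sum>h\<in>G. d h * h x)" for x
    proof -
      have "(\<Sum>h\<in>F \<union> G. e h * h x) = (\<Sum>h\<in>F \<union> G. (if h \<in> F then c h * h x else 0) + (if h \<in> G then d h * h x else 0))"
        by (intro sum.cong) (auto simp: e_def algebra_simps)
      also have "\<dots> = (\<Sum>h\<in>(F \<union> G) \<inter> F. c h * h x) + (\<Sum>h\<in>(F \<union> G) \<inter> G. d h * h x)"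
        using F(1) G(1) by (simp only: sum.distrib sum.inter_restrict finite_Un)
      finally show ?thesis by (simp add: Int_absorb1)
    qed
    have "(\<lambda>x. \<Sum>h\<in>F. c h * h x) \<in> L2 M" "(\<lambda>x. \<Sum>h\<in>G. d h * h x) \<in> L2 M"
      using F(2) G(2) B by (auto intro!: L2_lincomb)
    then have "(LINT x|M. (norm ((f x - (\<Sum>h\<in>F. c h * h x)) + (g x - (\<Sum>h\<in>G. d h * h x))))\<^sup>2)
       \<le> 2 * (LINT x|M. (norm (f x - (\<Sum>h\<in>F. c h * h x)))\<^sup>2) + 2 * (LINT x|M. (norm (g x - (\<Sum>h\<in>G. d h * h x)))\<^sup>2)"
      by (intro integral_norm_add_power2_le L2_diff fg[THEN L2_closed_span_L2])
    also have "\<dots> < \<epsilon>" using F(3) G(3) by simp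
    finally have "(LINT x|M. (norm (f x + g x - (\<Sum>h\<in>F \<union> G. e h * h x)))\<^sup>2) < \<epsilon>"
      unfolding S by (simp add: algebra_simps)
    then show ?thesis using F G by (intro exI[of _ "F \<union> G"] exI[of _ e]) auto
  qed
  then show ?thesis
    using L2_add[OF fg[THEN L2_closed_span_L2]] by (simp add: L2_closed_span_def)
qed

lemma L2_closed_span_cmult:
  assumes f: "f \<in> L2_closed_span M B"
  shows "(\<lambda>x. a * f x) \<in> L2_closed_span M B"
proof -
  have "\<exists>F c. finite F \<and> F \<subseteq> B \<and> (LINT x|M. (norm (a * f x - (\<Sum>g\<in>F. c g * g x)))\<^sup>2) < \<epsilon>" if "\<epsilon> > 0" for \<epsilon>
  proof -
    \<comment> \<open>The added 1 keeps the divisor positive when \<open>a\<close> is 0.\<close>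
    have pos: "(norm a)\<^sup>2 + 1 > 0" by (simp add: add_nonneg_pos)
    then obtain F c where F: "finite F" "F \<subseteq> B"
      "(LINT x|M. (norm (f x - (\<Sum>h\<in>F. c h * h x)))\<^sup>2) < \<epsilon> / ((norm a)\<^sup>2 + 1)" (is "?I < _")
      using L2_closed_spanD[OF f, of "\<epsilon> / ((norm a)\<^sup>2 + 1)"] \<open>\<epsilon> > 0\<close> by auto
    have eq: "a * f x - (\<Sum>h\<in>F. (a * c h) * h x) = a * (f x - (\<Sum>h\<in>F. c h * h x))" for x
      by (simp add: sum_distrib_left algebra_simps)
    have "(LINT x|M. (norm (a * f x - (\<Sum>h\<in>F. (a * c h) * h x)))\<^sup>2) = (norm a)\<^sup>2 * ?I"
      unfolding eq by (simp add: norm_mult power_mult_distrib)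
    also have "\<dots> \<le> ((norm a)\<^sup>2 + 1) * ?I"
      by (intro mult_right_mono) auto
    also have "\<dots> < \<epsilon>" using F(3) pos by (simp add: field_simps)
    finally show ?thesis using F(1,2) by (intro exI[of _ F] exI[of _ "\<lambda>h. a * c h"]) auto
  qed
  then show ?thesis
    using L2_cmult[OF L2_closed_span_L2[OF f]] by (simp add: L2_closed_span_def)
qed

lemma L2_closed_span_zero: "(\<lambda>_. 0) \<in> L2_closed_span M B"
  by (auto simp: L2_closed_span_def L2_def intro!: exI[of _ "{}"])

lemma L2_closed_span_diff:
  assumes "B \<subseteq> L2 M" "f \<in> L2_closed_span M B" "g \<in> L2_closed_span M B"
  shows "(\<lambda>x. f x - g x) \<in> L2_closed_span M B"
  using L2_closed_span_add[OF assms(1,2) L2_closed_span_cmult[OF assms(3), of "-1"]] by simp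

lemma L2_closed_span_sum:
  assumes "B \<subseteq> L2 M" "\<And>i. i \<in> F \<Longrightarrow> f i \<in> L2_closed_span M B"
  shows "(\<lambda>x. \<Sum>i\<in>F. f i x) \<in> L2_closed_span M B"
  using assms(2)
proof (induction F rule: infinite_finite_induct)
  case (insert i F)
  then show ?case using L2_closed_span_add[OF assms(1), of "f i" "\<lambda>x. \<Sum>i\<in>F. f i x"] by simp
qed (auto simp: L2_closed_span_zero)

text \<open>Dominated convergence applies to the squared errors, since two functions bounded by
  \<open>w\<close> differ by at most \<open>2 * w\<close>.\<close>

lemma L2_closed_span_LIMSEQ:
  assumes B: "B \<subseteq> L2 M" and f: "f \<in> borel_measurable M"
    and h: "\<And>i. h i \<in> L2_closed_span M B"
    and lim: "AE x in M. (\<lambda>i. h i x) \<longlonglongrightarrow> f x"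
    and bound: "\<And>i. AE x in M. norm (h i x) \<le> w x" "AE x in M. norm (f x) \<le> w x"
    and w: "integrable M (\<lambda>x. (w x)\<^sup>2)"
  shows "f \<in> L2_closed_span M B"
proof (rule L2_closed_span_closed[OF B])
  note [measurable] = f h[THEN L2_closed_span_L2, THEN L2_measurable]
  have "integrable M (\<lambda>x. (norm (f x))\<^sup>2)"
    by (rule Bochner_Integration.integrable_bound[OF w])
       (use bound(2) in \<open>auto elim!: eventually_mono intro!: power_mono\<close>)
  then show "f \<in> L2 M" using f by (simp add: L2_def)
  have "(\<lambda>i. LINT x|M. (norm (f x - h i x))\<^sup>2) \<longlonglongrightarrow> (LINT x|M. 0)"
  proof (rule integral_dominated_convergence)
    show "integrable M (\<lambda>x. 4 * (w x)\<^sup>2)" using w by simp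
    show "AE x in M. (\<lambda>i. (norm (f x - h i x))\<^sup>2) \<longlonglongrightarrow> 0"
      using lim
    proof eventually_elim
      fix x assume "(\<lambda>i. h i x) \<longlonglongrightarrow> f x"
      then have "(\<lambda>i. (norm (f x - h i x))\<^sup>2) \<longlonglongrightarrow> (norm (f x - f x))\<^sup>2"
        by (intro tendsto_intros)
      then show "(\<lambda>i. (norm (f x - h i x))\<^sup>2) \<longlonglongrightarrow> 0" by simp
    qed
    show "AE x in M. norm ((norm (f x - h i x))\<^sup>2) \<le> 4 * (w x)\<^sup>2" for i
      using bound(1)[of i] bound(2)
    proof eventually_elim
      fix x assume "norm (h i x) \<le> w x" "norm (f x) \<le> w x"
      then have "norm (f x - h i x) \<le> 2 * w x"
        using norm_triangle_ineq4[of "f x" "h i x"] by linarith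
      then have "(norm (f x - h i x))\<^sup>2 \<le> (2 * w x)\<^sup>2"
        by (intro power_mono) auto
      then show "norm ((norm (f x - h i x))\<^sup>2) \<le> 4 * (w x)\<^sup>2" by (simp add: power_mult_distrib)
    qed
  qed auto
  then have "(\<lambda>i. LINT x|M. (norm (f x - h i x))\<^sup>2) \<longlonglongrightarrow> 0" by simp
  then have "eventually (\<lambda>i. (LINT x|M. (norm (f x - h i x))\<^sup>2) < \<epsilon>) sequentially" if "\<epsilon> > 0" for \<epsilon>
    using order_tendstoD(2) that by blast
  then show "\<exists>g\<in>L2_closed_span M B. (LINT x|M. (norm (f x - g x))\<^sup>2) < \<epsilon>" if "\<epsilon> > 0" for \<epsilon>
    using h that eventually_happens'[OF sequentially_bot] by blast
qed

text \<open>A pi-lambda argument: indicators spread from the intersection-stable generator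
  \<open>G\<close> to all measurable sets, with \<open>space\<close> serving the complements. Simple
  functions follow by linearity, and every member of \<open>L2 M\<close> by simple approximations
  dominated by \<open>2 * norm (f x)\<close>.\<close>

lemma (in finite_measure) L2_eq_closed_span_indicator:
  assumes B: "B \<subseteq> L2 M"
    and G: "Int_stable G" "G \<subseteq> Pow (space M)" "sets M = sigma_sets (space M) G"
    and G_span: "\<And>A. A \<in> G \<Longrightarrow> indicator A \<in> L2_closed_span M B"
    and space: "(\<lambda>_. 1) \<in> L2_closed_span M B"
  shows "L2_closed_span M B = L2 M"
proof -
  \<comment> \<open>Functions are total, but integrals and measurability see only
    \<open>space M\<close>, so values outside it may be changed freely.\<close>
  have eq_on_space: "f \<in> L2_closed_span M B"
    if "f \<in> borel_measurable M" "g \<in> L2_closed_span M B" "\<And>x. x \<in> space M \<Longrightarrow> f x = g x" for f g :: "'a \<Rightarrow> complex"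
  proof (rule L2_closed_span_closed[OF B])
    have "integrable M (\<lambda>x. (norm (f x))\<^sup>2) = integrable M (\<lambda>x. (norm (g x))\<^sup>2)"
      using that(3) by (intro Bochner_Integration.integrable_cong) auto
    then show "f \<in> L2 M"
      using that(1) L2_closed_span_L2[OF that(2)] by (simp add: L2_def)
    show "\<exists>h\<in>L2_closed_span M B. (LINT x|M. (norm (f x - h x))\<^sup>2) < \<epsilon>" if "\<epsilon> > 0" for \<epsilon>
      using \<open>g \<in> _\<close> \<open>\<epsilon> > 0\<close> \<open>\<And>x. x \<in> space M \<Longrightarrow> f x = g x\<close>
      by (intro bexI[of _ g]) (auto simp: cong: Bochner_Integration.integral_cong)
  qed
  have ind: "(indicator A :: 'a \<Rightarrow> complex) \<in> L2_closed_span M B" if "A \<in> sets M" for A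
    using G(1,2) that[unfolded G(3)]
  proof (induction rule: sigma_sets_induct_disjoint)
    case (basic A)
    then show ?case by (rule G_span)
  next
    case empty
    then show ?case by (simp add: L2_closed_span_zero indicator_def[abs_def])
  next
    case (compl A)
    have [measurable]: "A \<in> sets M" using compl G(3) by simp
    show ?case
      by (rule eq_on_space[OF _ L2_closed_span_diff[OF B space compl(2)]])
         (auto simp: indicator_def)
  next
    case (union A)
    have A[measurable]: "A i \<in> sets M" for i using union(2) G(3) by auto
    show ?case
    proof (rule L2_closed_span_LIMSEQ[OF B, where h="\<lambda>i x. \<Sum>j<i. indicator (A j) x" and w="\<lambda>_. 1"])
      \<comment> \<open>Disjointness turns the partial sums into indicators of partial unions, so
        the constant 1 dominates them.\<close>
      have eq: "(\<Sum>j<i. indicator (A j) x) = (indicator (\<Union>j<i. A j) x :: complex)" for i x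
      proof (induction i)
        case (Suc i)
        have "x \<in> A i \<Longrightarrow> x \<notin> (\<Union>j<i. A j)"
          using disjoint_family_onD[OF union(1), of i] by force
        then show ?case
          by (simp only: sum.lessThan_Suc Suc.IH) (auto simp: lessThan_Suc indicator_def)
      qed simp
      show "AE x in M. (\<lambda>i. \<Sum>j<i. indicator (A j) x) \<longlonglongrightarrow> (indicator (\<Union>i. A i) x :: complex)"
        unfolding eq by (intro AE_I2 LIMSEQ_indicator_UN)
      show "AE x in M. norm (\<Sum>j<i. (indicator (A j) x :: complex)) \<le> 1" for i
        unfolding eq by (auto simp: indicator_def)
      show "(\<lambda>x. \<Sum>j<i. indicator (A j) x) \<in> L2_closed_span M B" for i
        by (intro L2_closed_span_sum[OF B] union(3))
    qed (auto simp: indicator_def)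
  qed
  have simple: "s \<in> L2_closed_span M B" if s: "simple_function M s" for s :: "'a \<Rightarrow> complex"
  proof (rule eq_on_space)
    show "s \<in> borel_measurable M" using s by (rule borel_measurable_simple_function)
    show "(\<lambda>x. \<Sum>y\<in>s ` space M. y * indicator (s -` {y} \<inter> space M) x) \<in> L2_closed_span M B"
      using s by (intro L2_closed_span_sum[OF B] L2_closed_span_cmult ind simple_functionD)
    show "s x = (\<Sum>y\<in>s ` space M. y * indicator (s -` {y} \<inter> space M) x)" if "x \<in> space M" for x
      by (rule trans[OF simple_function_indicator_representation_banach[OF s that]])
         (auto intro!: sum.cong split: split_indicator)
  qed
  have "f \<in> L2_closed_span M B" if f: "f \<in> L2 M" for f
  proof -
    from borel_measurable_implies_sequence_metric[OF L2_measurable[OF f], of 0]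
    obtain s where s: "\<forall>i. simple_function M (s i)" "\<forall>x\<in>space M. (\<lambda>i. s i x) \<longlonglongrightarrow> f x"
      "\<forall>i. \<forall>x\<in>space M. dist (s i x) 0 \<le> 2 * dist (f x) 0"
      by (elim exE conjE)
    show ?thesis
    proof (rule L2_closed_span_LIMSEQ[OF B L2_measurable[OF f], where h=s and w="\<lambda>x. 2 * norm (f x)"])
      show "s i \<in> L2_closed_span M B" for i
        using s(1) by (intro simple) blast
      show "AE x in M. (\<lambda>i. s i x) \<longlonglongrightarrow> f x"
        using s(2) by (intro AE_I2) blast
      show "AE x in M. norm (s i x) \<le> 2 * norm (f x)" for i
        using s(3) by (intro AE_I2) simp
      show "integrable M (\<lambda>x. (2 * norm (f x))\<^sup>2)"
        using L2_integrable[OF f] by (simp add: power_mult_distrib)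
    qed auto
  qed
  then show ?thesis using L2_closed_span_L2 by blast
qed

section \<open>Density of the exponentials for measures on [-1, 1]\<close>

lemma sin_power_expo_span:
  assumes B: "B \<subseteq> L2 M" and expo: "\<And>t. expo t \<in> L2_closed_span M B"
  shows "(\<lambda>x. of_real (sin x ^ i) * expo t x) \<in> L2_closed_span M B"
proof (induction i arbitrary: t)
  case 0
  then show ?case using expo by simp
next
  case (Suc i)
  \<comment> \<open>The sine combines the frequencies 1/(2 pi) and -1/(2 pi), so one more factor
    \<open>sin x\<close> only shifts \<open>t\<close>; hence the induction leaves \<open>t\<close>
    arbitrary.\<close>
  have sin: "of_real (sin x) = - \<i> / 2 * (expo (1 / (2 * pi)) x - expo (- (1 / (2 * pi))) x)" for x
    by (simp add: expo_def sin_exp_eq sin_of_real[symmetric] field_simps)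
  have eq: "of_real (sin x ^ Suc i) * expo t x = - \<i> / 2 *
     (of_real (sin x ^ i) * expo (t + 1 / (2 * pi)) x - of_real (sin x ^ i) * expo (t + - (1 / (2 * pi))) x)" for x
    by (simp only: power_Suc of_real_mult sin expo_add) (simp add: algebra_simps)
  show ?case
    unfolding eq by (intro L2_closed_span_cmult L2_closed_span_diff[OF B] Suc)
qed

text \<open>On \<open>[-1, 1]\<close> the function \<open>sin\<close> is injective, so a continuous \<open>g\<close> is approximated by
  \<open>q (sin x)\<close> with a polynomial \<open>q\<close> close to \<open>g \<circ> arcsin\<close>.\<close>

lemma continuous_in_expo_span:
  fixes M :: "real measure" and g :: "real \<Rightarrow> real"
  assumes fin: "finite_measure M" and M: "sets M = sets borel" and supp: "AE x in M. \<bar>x\<bar> \<le> 1"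
    and B: "B \<subseteq> L2 M" and expo: "\<And>t. expo t \<in> L2_closed_span M B"
    and g: "continuous_on UNIV g"
  shows "(\<lambda>x. of_real (g x)) \<in> L2_closed_span M B"
proof -
  interpret finite_measure M by (rule fin)
  have [measurable]: "g \<in> borel_measurable M"
    using borel_measurable_continuous_onI[OF g] M by (simp cong: measurable_cong_sets)
  have "continuous_on {-1..1} (\<lambda>y. g (arcsin y))"
    by (intro continuous_on_compose2[OF g] continuous_on_arcsin') auto
  then have "\<exists>q. real_polynomial_function q \<and> (\<forall>y\<in>{-1..1}. \<bar>g (arcsin y) - q y\<bar> < 1 / real (Suc i))" for i
    using Stone_Weierstrass_real_polynomial_function[of "{-1..1}" "\<lambda>y. g (arcsin y)" "1 / real (Suc i)"]
    by (metis compact_Icc of_nat_0_less_iff zero_less_Suc divide_pos_pos zero_less_one)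
  then obtain q where q: "\<And>i. real_polynomial_function (q i)"
    "\<And>i y. y \<in> {-1..1} \<Longrightarrow> \<bar>g (arcsin y) - q i y\<bar> < 1 / real (Suc i)" by metis
  \<comment> \<open>\<open>arcsin_sin\<close> asks for an argument in [-pi/2, pi/2]; by
    \<open>pi_ge_two\<close> this interval contains [-1, 1].\<close>
  have close: "\<bar>g x - q i (sin x)\<bar> < 1 / real (Suc i)" if "\<bar>x\<bar> \<le> 1" for i x
    using q(2)[of "sin x" i] that pi_ge_two by (simp add: arcsin_sin)
  obtain C where C: "\<And>x. \<bar>x\<bar> \<le> 1 \<Longrightarrow> \<bar>g x\<bar> \<le> C"
  proof -
    have "bounded (g ` {-1..1})"
      by (intro compact_imp_bounded compact_continuous_image continuous_on_subset[OF g]) auto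
    then obtain a where "\<forall>y\<in>g ` {-1..1}. norm y \<le> a" by (auto simp: bounded_iff)
    then show ?thesis by (intro that[of a]) (auto simp: abs_le_iff)
  qed
  show ?thesis
  proof (rule L2_closed_span_LIMSEQ[OF B, where h="\<lambda>i x. of_real (q i (sin x))" and w="\<lambda>_. C + 1"])
    show "(\<lambda>x. of_real (q i (sin x))) \<in> L2_closed_span M B" for i
    proof -
      obtain a n where a: "q i = (\<lambda>x. \<Sum>j\<le>n. a j * x ^ j)"
        using q(1)[of i] by (auto simp: real_polynomial_function_iff_sum)
      have "(\<lambda>x. \<Sum>j\<le>n. of_real (a j) * (of_real (sin x ^ j) * expo 0 x)) \<in> L2_closed_span M B"
        by (intro L2_closed_span_sum[OF B] L2_closed_span_cmult sin_power_expo_span[OF B] expo)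
      then show ?thesis by (simp add: a)
    qed
    show "AE x in M. (\<lambda>i. complex_of_real (q i (sin x))) \<longlonglongrightarrow> of_real (g x)"
      using supp
    proof eventually_elim
      fix x :: real assume "\<bar>x\<bar> \<le> 1"
      then have "(\<lambda>i. q i (sin x)) \<longlonglongrightarrow> g x"
        using close[of x]
        by (intro LIM_zero_cancel[OF Lim_null_comparison[OF _ LIMSEQ_Suc[OF lim_inverse_n']]])
           (auto simp: abs_minus_commute less_imp_le)
      then show "(\<lambda>i. complex_of_real (q i (sin x))) \<longlonglongrightarrow> of_real (g x)"
        by (rule tendsto_of_real)
    qed
    show "AE x in M. norm (complex_of_real (q i (sin x))) \<le> C + 1" for i
      using supp
    proof eventually_elim
      fix x :: real assume x: "\<bar>x\<bar> \<le> 1"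
      \<comment> \<open>All approximation errors are at most 1, which explains the dominating
        constant \<open>C + 1\<close>.\<close>
      have "1 / real (Suc i) \<le> 1" by simp
      then show "norm (complex_of_real (q i (sin x))) \<le> C + 1"
        using close[OF x, of i] C[OF x] by (simp only: norm_of_real)
    qed
    show "AE x in M. norm (complex_of_real (g x)) \<le> C + 1"
      using supp by eventually_elim (use C in force)
  qed auto
qed

text \<open>Open rays form an intersection-stable generator of the Borel sets. Their indicators are
  pointwise limits of continuous ramps, which \<open>continuous_in_expo_span\<close> covers, so
  \<open>L2_eq_closed_span_indicator\<close> applies.\<close>

lemma L2_eq_expo_span:
  fixes M :: "real measure"
  assumes fin: "finite_measure M" and M: "sets M = sets borel" and supp: "AE x in M. \<bar>x\<bar> \<le> 1"
    and B: "B \<subseteq> L2 M" and expo: "\<And>t. expo t \<in> L2_closed_span M B"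
  shows "L2_closed_span M B = L2 M"
proof (rule finite_measure.L2_eq_closed_span_indicator[OF fin B])
  have sp: "space M = UNIV" using sets_eq_imp_space_eq[OF M] by simp
  let ?G = "range (\<lambda>a::real. {a<..})"
  show "Int_stable ?G"
  proof (rule Int_stableI_image)
    show "\<exists>c\<in>UNIV. {a<..} \<inter> {b<..} = {c<..}" for a b :: real
      by (intro bexI[of _ "max a b"]) auto
  qed
  show "sets M = sigma_sets (space M) ?G"
    using M sp by (simp add: borel_Ioi)
  show "?G \<subseteq> Pow (space M)" using sp by simp
  have "expo 0 = (\<lambda>_. 1)" by auto
  then show "(\<lambda>_. 1) \<in> L2_closed_span M B" using expo[of 0] by simp
  fix A assume "A \<in> ?G"
  then obtain a where A: "A = {a<..}" by auto
  \<comment> \<open>For positive \<open>i\<close> the ramp climbs from 0 at \<open>a\<close> to 1 at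
    \<open>a + 1 / i\<close>. Its value 0 at \<open>a\<close> itself matches the openness of the
    ray.\<close>
  let ?h = "\<lambda>i x. min 1 (max 0 (real i * (x - a)))"
  show "indicator A \<in> L2_closed_span M B"
  proof (rule L2_closed_span_LIMSEQ[OF B, where h="\<lambda>i x. of_real (?h i x)" and w="\<lambda>_. 1"])
    show "(\<lambda>x. of_real (?h i x)) \<in> L2_closed_span M B" for i
      by (rule continuous_in_expo_span[OF fin M supp B expo]) (intro continuous_intros)
    have "(\<lambda>i. ?h i x) \<longlonglongrightarrow> indicator {a<..} x" for x
    proof (cases "x > a")
      case True
      obtain N where N: "1 / (x - a) \<le> real N" using real_arch_simple by blast
      have "?h i x = 1" if "i \<ge> N" for i
      proof -
        have "1 \<le> real N * (x - a)" using N True by (simp add: field_simps)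
        also have "\<dots> \<le> real i * (x - a)" using that True by (intro mult_right_mono) auto
        finally show ?thesis by simp
      qed
      then have "eventually (\<lambda>i. ?h i x = 1) sequentially"
        by (auto simp: eventually_sequentially)
      with True show ?thesis by (simp add: tendsto_eventually)
    next
      case False
      then have "real i * (x - a) \<le> 0" for i
        by (simp add: mult_nonneg_nonpos)
      then have "?h i x = 0" for i
        by (simp add: max_absorb1)
      with False show ?thesis by simp
    qed
    then have lim: "(\<lambda>i. complex_of_real (?h i x)) \<longlonglongrightarrow> of_real (indicator {a<..} x)" for x
      by (rule tendsto_of_real)
    have "of_real (indicator {a<..} x) = (indicator A x :: complex)" for x
      by (simp add: A indicator_def)
    then show "AE x in M. (\<lambda>i. complex_of_real (?h i x)) \<longlonglongrightarrow> indicator A x"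
      using lim by (intro AE_I2) (rule subst)
    show "indicator A \<in> borel_measurable M"
      by (rule borel_measurable_indicator) (simp add: M A)
  qed (auto simp: indicator_def finite_measure.integrable_const[OF fin])
qed

section \<open>Inner products and orthogonal projection\<close>

lemma integrable_L2_mult_cnj:
  assumes "f \<in> L2 M" "g \<in> L2 M"
  shows "integrable M (\<lambda>x. f x * cnj (g x))"
proof (rule Bochner_Integration.integrable_bound[where f="\<lambda>x. (norm (f x))\<^sup>2 + (norm (g x))\<^sup>2"])
  note [measurable] = assms[THEN L2_measurable]
  show "integrable M (\<lambda>x. (norm (f x))\<^sup>2 + (norm (g x))\<^sup>2)"
    using assms by (simp add: L2_integrable)
  show "(\<lambda>x. f x * cnj (g x)) \<in> borel_measurable M"
    by (intro borel_measurable_times borel_measurable_continuous_on[OF _ assms(2)[THEN L2_measurable]]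
        assms(1)[THEN L2_measurable] continuous_intros)
  have "norm (f x * cnj (g x)) \<le> (norm (f x))\<^sup>2 + (norm (g x))\<^sup>2" for x
    using sum_squares_bound[of "norm (f x)" "norm (g x)"] mult_nonneg_nonneg[OF norm_ge_zero[of "f x"] norm_ge_zero[of "g x"]]
    unfolding norm_mult complex_mod_cnj by linarith
  then show "AE x in M. norm (f x * cnj (g x)) \<le> norm ((norm (f x))\<^sup>2 + (norm (g x))\<^sup>2)"
    by simp
qed

lemma L2_inner_self: "L2_inner M f f = of_real (LINT x|M. (norm (f x))\<^sup>2)"
  by (simp only: L2_inner_def complex_norm_square[symmetric] integral_complex_of_real)

lemma L2_inner_cnj: "cnj (L2_inner M f g) = L2_inner M g f"
  unfolding L2_inner_def by (subst Bochner_Integration.integral_cnj[symmetric]) (simp add: mult.commute)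

lemma L2_inner_diff_left:
  assumes "f \<in> L2 M" "g \<in> L2 M" "h \<in> L2 M"
  shows "L2_inner M (\<lambda>x. f x - g x) h = L2_inner M f h - L2_inner M g h"
  using assms by (simp add: L2_inner_def left_diff_distrib integrable_L2_mult_cnj)

lemma L2_inner_diff_right:
  assumes "f \<in> L2 M" "g \<in> L2 M" "h \<in> L2 M"
  shows "L2_inner M h (\<lambda>x. f x - g x) = L2_inner M h f - L2_inner M h g"
  using L2_inner_diff_left[OF assms, THEN arg_cong[where f=cnj]] by (simp add: L2_inner_cnj)

lemma L2_inner_lincomb_right:
  assumes "f \<in> L2 M" "F \<subseteq> L2 M"
  shows "L2_inner M f (\<lambda>x. \<Sum>g\<in>F. c g * g x) = (\<Sum>g\<in>F. cnj (c g) * L2_inner M f g)"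
proof -
  have "f x * cnj (\<Sum>g\<in>F. c g * g x) = (\<Sum>g\<in>F. cnj (c g) * (f x * cnj (g x)))" for x
    by (simp add: sum_distrib_left mult_ac)
  then show ?thesis
    using assms unfolding L2_inner_def
    by (subst integral_mult_right[symmetric] | simp add: integrable_L2_mult_cnj subset_iff
        Bochner_Integration.integral_sum)+
qed

lemma orthonormal_L2_subset: "orthonormal_L2 M B \<Longrightarrow> F \<subseteq> B \<Longrightarrow> orthonormal_L2 M F"
  by (simp add: orthonormal_L2_def subset_eq)

text \<open>When the square is expanded, both mixed terms and the square of the projection equal the
  same sum of squared coefficients. The formula serves twice: nonnegativity of the left side yields
  Bessel's inequality, and Parseval's identity makes it tend to 0.\<close>

lemma orthonormal_L2_distance:
  assumes on: "orthonormal_L2 M F" and fin: "finite F" and f: "f \<in> L2 M"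
  shows "(LINT x|M. (norm (f x - (\<Sum>g\<in>F. L2_inner M f g * g x)))\<^sup>2) =
    (LINT x|M. (norm (f x))\<^sup>2) - (\<Sum>g\<in>F. (norm (L2_inner M f g))\<^sup>2)"
proof -
  let ?c = "L2_inner M f" and ?s = "\<Sum>g\<in>F. (norm (L2_inner M f g))\<^sup>2"
  let ?S = "\<lambda>x. \<Sum>g\<in>F. ?c g * g x"
  have F: "F \<subseteq> L2 M" using on by (simp add: orthonormal_L2_def)
  have S: "?S \<in> L2 M" by (rule L2_lincomb[OF F])
  have norm: "(\<Sum>g\<in>F. cnj (?c g) * ?c g) = of_real ?s"
    by (simp only: of_real_sum complex_norm_square mult.commute)
  have fS: "L2_inner M f ?S = of_real ?s"
    unfolding L2_inner_lincomb_right[OF f F] by (rule norm)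
  then have Sf: "L2_inner M ?S f = of_real ?s"
    using L2_inner_cnj[of M f ?S] by (simp only: complex_cnj_complex_of_real)
  have "L2_inner M ?S g = ?c g" if g: "g \<in> F" for g
  proof -
    have "L2_inner M g ?S = (\<Sum>h\<in>F. cnj (?c h) * (if g = h then 1 else 0))"
      using on F g by (subst L2_inner_lincomb_right) (auto simp: orthonormal_L2_def intro!: sum.cong)
    also have "\<dots> = cnj (?c g)"
      using fin g by (simp add: if_distrib cong: if_cong)
    finally show ?thesis
      using L2_inner_cnj[of M g ?S] by (simp only: complex_cnj_cnj)
  qed
  then have SS: "L2_inner M ?S ?S = of_real ?s"
    unfolding L2_inner_lincomb_right[OF S F] norm[symmetric] by (intro sum.cong) auto
  have "complex_of_real (LINT x|M. (norm (f x - ?S x))\<^sup>2) = L2_inner M f f - of_real ?s"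
    unfolding L2_inner_self[symmetric]
    by (simp only: L2_inner_diff_left[OF f S L2_diff[OF f S]] L2_inner_diff_right[OF f S] f S fS Sf SS)
       simp
  then have "complex_of_real (LINT x|M. (norm (f x - ?S x))\<^sup>2) = of_real ((LINT x|M. (norm (f x))\<^sup>2) - ?s)"
    by (simp add: L2_inner_self)
  then show ?thesis by (simp only: of_real_eq_iff)
qed

subsection \<open>Orthogonality and Parseval's identity\<close>

text \<open>Here \<open>m\<close> is the least position at which the sets differ. After division by
  \<open>b ^ m\<close> the term at \<open>m\<close> is 1 or -1 and all other remaining terms are
  even, so the quotient is odd.\<close>

lemma power_sum_diff:
  fixes b :: int
  assumes "even b" "finite A" "finite B" "A \<noteq> B"
  obtains m q where "odd q" "(\<Sum>k\<in>A. b ^ k) - (\<Sum>k\<in>B. b ^ k) = b ^ m * q"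
proof -
  let ?S = "(A - B) \<union> (B - A)"
  define m where "m = Min ?S"
  have S: "finite ?S" "?S \<noteq> {}" using assms by auto
  then have m: "m \<in> ?S" unfolding m_def by (rule Min_in)
  have le: "m \<le> k" if "k \<in> ?S" for k using S that by (simp add: m_def)
  let ?q = "\<lambda>X. \<Sum>k\<in>X. b ^ (k - m)"
  have split: "(\<Sum>k\<in>X. b ^ k) = b ^ m * ?q X" if "X \<subseteq> ?S" for X
    unfolding sum_distrib_left
    by (intro sum.cong refl) (use le that in \<open>auto simp: power_add[symmetric]\<close>)
  have parity: "even (?q X) \<longleftrightarrow> m \<notin> X" if "X \<subseteq> ?S" for X
  proof -
    have "odd (b ^ (k - m)) \<longleftrightarrow> k = m" if "k \<in> X" for k
      using le[of k] that \<open>X \<subseteq> ?S\<close> \<open>even b\<close> by auto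
    then have "{k \<in> X. odd (b ^ (k - m))} = {k \<in> X. k = m}"
      by blast
    also have "\<dots> = (if m \<in> X then {m} else {})"
      by auto
    finally show ?thesis using finite_subset[OF that S(1)] by (simp add: even_sum_iff)
  qed
  have "(\<Sum>k\<in>A. b ^ k) - (\<Sum>k\<in>B. b ^ k) = (\<Sum>k\<in>A - B. b ^ k) - (\<Sum>k\<in>B - A. b ^ k)"
    using assms(2,3) sum.Int_Diff[of A "\<lambda>k. b ^ k" B] sum.Int_Diff[of B "\<lambda>k. b ^ k" A]
    by (simp add: Int_commute)
  also have "\<dots> = b ^ m * (?q (A - B) - ?q (B - A))"
    using split[of "A - B"] split[of "B - A"] by (simp add: right_diff_distrib)
  finally have "(\<Sum>k\<in>A. b ^ k) - (\<Sum>k\<in>B. b ^ k) = b ^ m * (?q (A - B) - ?q (B - A))" .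
  moreover have "odd (?q (A - B) - ?q (B - A))"
    using parity[of "A - B"] parity[of "B - A"] m by auto
  ultimately show ?thesis by (intro that)
qed

text \<open>A frequency is indexed by the finite set of positions that carry the digit
  \<open>n / 2\<close>. Truncation to \<open>N\<close> digits then becomes
  \<open>Pow {..<N}\<close>.\<close>

definition freq :: "nat \<Rightarrow> nat \<Rightarrow> nat set \<Rightarrow> real" where
  "freq n p A = real p * (real n / 2 * (\<Sum>k\<in>A. (2 * real n) ^ k))"

lemma Gamma_set_eq:
  assumes "n > 0"
  shows "(\<lambda>\<gamma>. real p * \<gamma>) ` Gamma_set n = freq n p ` {A. finite A}"
proof -
  have "Gamma_set n = (\<lambda>A. real n / 2 * (\<Sum>k\<in>A. (2 * real n) ^ k)) ` {A. finite A}"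
  proof (intro equalityI subsetI)
    fix x assume "x \<in> Gamma_set n"
    then obtain N a where x: "x = (\<Sum>k=0..N. a k * (2 * real n) ^ k)" and a: "\<forall>k\<le>N. a k \<in> {0, real n / 2}"
      by (auto simp: Gamma_set_def)
    have "x = (\<Sum>k\<in>{k\<in>{0..N}. a k \<noteq> 0}. real n / 2 * (2 * real n) ^ k)"
      unfolding x by (rule sum.mono_neutral_cong_right) (use a in auto)
    then show "x \<in> (\<lambda>A. real n / 2 * (\<Sum>k\<in>A. (2 * real n) ^ k)) ` {A. finite A}"
      unfolding sum_distrib_left by (rule image_eqI) simp
  next
    fix x assume "x \<in> (\<lambda>A. real n / 2 * (\<Sum>k\<in>A. (2 * real n) ^ k)) ` {A. finite A}"
    then obtain A where A: "finite A" and x: "x = real n / 2 * (\<Sum>k\<in>A. (2 * real n) ^ k)"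
      by (elim imageE CollectE)
    obtain N where "\<forall>k\<in>A. k \<le> N"
      using A unfolding finite_nat_set_iff_bounded_le by blast
    then have N: "A \<subseteq> {0..N}" by auto
    have "x = (\<Sum>k=0..N. (if k \<in> A then real n / 2 else 0) * (2 * real n) ^ k)"
      unfolding x sum_distrib_left by (rule sum.mono_neutral_cong_left) (use N in auto)
    moreover have "\<forall>k\<le>N. (if k \<in> A then real n / 2 else 0) \<in> {0, real n / 2}" by simp
    ultimately show "x \<in> Gamma_set n"
      unfolding Gamma_set_def
      by (intro CollectI exI[of _ N] exI[of _ "\<lambda>k. if k \<in> A then real n / 2 else 0"] conjI)
  qed
  then show ?thesis by (simp add: image_image freq_def)
qed

text \<open>By \<open>power_sum_diff\<close> the difference is
  \<open>p * n / 2 * (2 * n) ^ m * q\<close> with \<open>q\<close> odd. The factor of index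
  \<open>m\<close> is therefore the cosine of an odd multiple of pi/2, and this zero annihilates the
  product.\<close>

lemma bernoulli_ft_freq_diff:
  assumes n: "n > 0" and p: "odd p" and AB: "finite A" "finite B" "A \<noteq> B"
  shows "bernoulli_ft (1 / (2 * real n)) (freq n p A - freq n p B) = 0"
proof -
  let ?b = "2 * int n" and ?l = "1 / (2 * real n)"
  let ?s = "freq n p A - freq n p B"
  have "even ?b" by simp
  then obtain m q where q: "odd q" and "(\<Sum>k\<in>A. ?b ^ k) - (\<Sum>k\<in>B. ?b ^ k) = ?b ^ m * q"
    by (rule power_sum_diff[OF _ AB])
  from arg_cong[OF this(2), of real_of_int]
  have "(\<Sum>k\<in>A. (2 * real n) ^ k) - (\<Sum>k\<in>B. (2 * real n) ^ k) = (2 * real n) ^ m * real_of_int q"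
    by simp
  then have "?s = real p * (real n / 2 * ((2 * real n) ^ m * real_of_int q))"
    unfolding freq_def by (simp only: right_diff_distrib[symmetric])
  then have "2 * pi * ?s * ?l ^ Suc m = of_int (int p * q) * (pi / 2)"
    using n by (simp add: power_divide field_simps)
  moreover have "odd (int p * q)" using p q by simp
  ultimately have "cos (2 * pi * ?s * ?l ^ Suc m) = 0"
    unfolding cos_zero_iff_int by blast
  then have "cos_prod ?l (Suc m) ?s = 0"
    by (simp add: cos_prod_def)
  moreover have "\<bar>?l\<bar> < 1" using n by simp
  ultimately show ?thesis
    using bernoulli_ft_split[of ?l ?s "Suc m"] by simp
qed

section \<open>Exact sums for the truncated transforms and their limit\<close>

lemma freq_insert:
  "finite A \<Longrightarrow> k \<notin> A \<Longrightarrow> freq n p (insert k A) = freq n p A + real p * (real n / 2 * (2 * real n) ^ k)"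
  by (simp add: freq_def algebra_simps)

lemma cos_diff_int_pi_squared: "(cos (x - pi * of_int i))\<^sup>2 = (cos x)\<^sup>2"
proof -
  have "sin (pi * of_int i) = 0"
    by (metis mult.commute sin_zero_iff_int2)
  moreover from this have "(cos (pi * of_int i))\<^sup>2 = 1"
    by (simp add: cos_squared_eq)
  ultimately show ?thesis
    by (simp add: cos_diff power_mult_distrib)
qed

lemma cos_diff_odd_half_pi_squared:
  assumes "odd i"
  shows "(cos (x - of_int i * (pi / 2)))\<^sup>2 = (sin x)\<^sup>2"
proof -
  have "cos (of_int i * (pi / 2)) = 0"
    using assms by (auto simp: cos_zero_iff_int)
  moreover from this have "(sin (of_int i * (pi / 2)))\<^sup>2 = 1"
    by (simp add: sin_squared_eq)
  ultimately show ?thesis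
    by (simp add: cos_diff power_mult_distrib)
qed

text \<open>Modulo signs, the \<open>k\<close>-th factor of the product depends only on the digits up to \<open>k\<close>, and the
  digit \<open>k\<close> exchanges \<open>cos\<close> and \<open>sin\<close>; so the sum telescopes from the top digit downwards.\<close>

lemma sum_cos_prod_squared:
  assumes n: "n > 0" and p: "odd p"
  shows "(\<Sum>A\<in>Pow {..<N}. (cos_prod (1 / (2 * real n)) N (t - freq n p A))\<^sup>2) = 1"
proof (induction N)
  case 0
  then show ?case by (simp add: cos_prod_def)
next
  case (Suc N)
  let ?l = "1 / (2 * real n)" and ?c = "real p * (real n / 2 * (2 * real n) ^ N)"
  \<comment> \<open>The digit at \<open>N\<close> moves the angle of every earlier factor by an
    integer multiple of pi, which squaring hides.\<close>
  have lower: "(cos_prod ?l N (s - ?c))\<^sup>2 = (cos_prod ?l N s)\<^sup>2" for s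
    unfolding cos_prod_def prod_power_distrib
  proof (intro prod.cong refl)
    fix k assume "k \<in> {..<N}"
    then obtain j where j: "N = Suc k + j" by (auto simp: less_iff_Suc_add)
    have "?c * ?l ^ Suc k = real p * (real n / 2 * (2 * real n) ^ j)"
      unfolding j using n by (simp add: power_add power_divide field_simps)
    then have "2 * pi * (s - ?c) * ?l ^ Suc k
        = 2 * pi * s * ?l ^ Suc k - pi * of_int (int p * int n * (2 * int n) ^ j)"
      by (simp only: left_diff_distrib right_diff_distrib mult.assoc) simp
    then show "(cos (2 * pi * (s - ?c) * ?l ^ Suc k))\<^sup>2 = (cos (2 * pi * s * ?l ^ Suc k))\<^sup>2"
      by (simp only: cos_diff_int_pi_squared)
  qed
  \<comment> \<open>In the last factor the shift is \<open>p\<close> quarter turns; since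
    \<open>p\<close> is odd, cosine becomes sine up to sign.\<close>
  have top: "(cos (2 * pi * (s - ?c) * ?l ^ Suc N))\<^sup>2 = (sin (2 * pi * s * ?l ^ Suc N))\<^sup>2" for s
  proof -
    have "2 * pi * (s - ?c) * ?l ^ Suc N = 2 * pi * s * ?l ^ Suc N - of_int (int p) * (pi / 2)"
      using n by (simp add: power_divide field_simps)
    then show ?thesis using p by (simp only: cos_diff_odd_half_pi_squared even_of_nat not_False_eq_True)
  qed
  have step: "(cos_prod ?l (Suc N) s)\<^sup>2 = (cos_prod ?l N s)\<^sup>2 * (cos (2 * pi * s * ?l ^ Suc N))\<^sup>2" for s
    by (simp add: cos_prod_def power_mult_distrib)
  have inj: "inj_on (insert N) (Pow {..<N})"
    by (auto simp: inj_on_def)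
  have "(\<Sum>A\<in>insert N ` Pow {..<N}. (cos_prod ?l (Suc N) (t - freq n p A))\<^sup>2)
      = (\<Sum>A\<in>Pow {..<N}. (cos_prod ?l (Suc N) (t - freq n p A - ?c))\<^sup>2)"
    unfolding sum.reindex[OF inj]
  proof (intro sum.cong refl)
    fix A assume "A \<in> Pow {..<N}"
    then have "finite A" "N \<notin> A" by (auto intro: finite_subset)
    then show "((\<lambda>A. (cos_prod ?l (Suc N) (t - freq n p A))\<^sup>2) \<circ> insert N) A
        = (cos_prod ?l (Suc N) (t - freq n p A - ?c))\<^sup>2"
      by (simp only: freq_insert o_def diff_diff_eq not_False_eq_True)
  qed
  also have "\<dots> = (\<Sum>A\<in>Pow {..<N}. (cos_prod ?l N (t - freq n p A))\<^sup>2 *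
      (sin (2 * pi * (t - freq n p A) * ?l ^ Suc N))\<^sup>2)"
    unfolding step lower top ..
  \<comment> \<open>The subsets fall into pairs \<open>A\<close>, \<open>insert N A\<close>, and
    each pair contributes the squared earlier product times \<open>cos^2 + sin^2\<close>.\<close>
  finally have "(\<Sum>A\<in>Pow {..<Suc N}. (cos_prod ?l (Suc N) (t - freq n p A))\<^sup>2)
      = (\<Sum>A\<in>Pow {..<N}. (cos_prod ?l (Suc N) (t - freq n p A))\<^sup>2) +
        (\<Sum>A\<in>Pow {..<N}. (cos_prod ?l N (t - freq n p A))\<^sup>2 * (sin (2 * pi * (t - freq n p A) * ?l ^ Suc N))\<^sup>2)"
    unfolding lessThan_Suc Pow_insert by (subst sum.union_disjoint) auto
  also have "\<dots> = (\<Sum>A\<in>Pow {..<N}. (cos_prod ?l N (t - freq n p A))\<^sup>2)"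
    unfolding step sum.distrib[symmetric] distrib_left[symmetric] by simp
  finally show ?case using Suc by simp
qed

text \<open>A geometric sum bounds a frequency with \<open>N\<close> digits by
  \<open>p * n / 2 * (2 * n) ^ N / (2 * n - 1)\<close>. After scaling, its share of the first angle
  is at most \<open>r\<close>, and \<open>r < 1\<close> is precisely the bound on \<open>p\<close>.
  The share of \<open>t\<close> tends to 0 and eventually fits into \<open>1 - r\<close>, as
  \<open>bernoulli_ft_lower_bound\<close> requires.\<close>

lemma bernoulli_ft_freq_tail_bound:
  assumes n: "n \<ge> 2" and p: "real p < 2 * (2 * real n - 1) / pi"
  shows "eventually (\<lambda>N. \<forall>A\<in>Pow {..<N}.
    7 / 15 \<le> bernoulli_ft (1 / (2 * real n)) ((1 / (2 * real n)) ^ N * (t - freq n p A))) sequentially"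
proof -
  let ?l = "1 / (2 * real n)"
  define r where "r = pi * real p / (2 * (2 * real n - 1))"
  have r: "r < 1" using p n by (simp add: r_def field_simps)
  have "(\<lambda>N. 2 * pi * ?l * (?l ^ N * \<bar>t\<bar>)) \<longlonglongrightarrow> 2 * pi * ?l * (0 * \<bar>t\<bar>)"
    using n by (intro tendsto_intros LIMSEQ_power_zero) auto
  then have "eventually (\<lambda>N. 2 * pi * ?l * (?l ^ N * \<bar>t\<bar>) < 1 - r) sequentially"
    using r by (intro order_tendstoD(2)) auto
  then show ?thesis
  proof eventually_elim
    case (elim N)
    show ?case
    proof
      fix A assume "A \<in> Pow {..<N}"
      then have "(\<Sum>k\<in>A. (2 * real n) ^ k) \<le> (\<Sum>k<N. (2 * real n) ^ k)"
        by (intro sum_mono2) auto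
      also have "\<dots> \<le> (2 * real n) ^ N / (2 * real n - 1)"
        using n by (subst sum_gp_strict) (auto simp: field_simps)
      finally have "freq n p A \<le> real p * (real n / 2 * ((2 * real n) ^ N / (2 * real n - 1)))"
        unfolding freq_def by (intro mult_left_mono) auto
      then have "2 * pi * ?l * (?l ^ N * freq n p A)
          \<le> 2 * pi * ?l * (?l ^ N * (real p * (real n / 2 * ((2 * real n) ^ N / (2 * real n - 1)))))"
        by (intro mult_left_mono) auto
      also have "\<dots> = r"
        using n by (simp add: r_def power_divide field_simps)
      finally have f: "2 * pi * ?l * (?l ^ N * freq n p A) \<le> r" .
      have "\<bar>?l ^ N * (t - freq n p A)\<bar> \<le> ?l ^ N * \<bar>t\<bar> + ?l ^ N * freq n p A"
      proof -
        have "0 \<le> freq n p A" by (auto simp: freq_def intro!: mult_nonneg_nonneg sum_nonneg)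
        then have "\<bar>t - freq n p A\<bar> \<le> \<bar>t\<bar> + freq n p A" by linarith
        then have "?l ^ N * \<bar>t - freq n p A\<bar> \<le> ?l ^ N * (\<bar>t\<bar> + freq n p A)"
          by (intro mult_left_mono) auto
        then show ?thesis by (simp add: abs_mult distrib_left)
      qed
      then have "2 * pi * ?l * \<bar>?l ^ N * (t - freq n p A)\<bar>
          \<le> 2 * pi * ?l * (?l ^ N * \<bar>t\<bar> + ?l ^ N * freq n p A)"
        by (intro mult_left_mono) auto
      also have "\<dots> \<le> 1"
        using f elim by (simp only: distrib_left)
      finally have "2 * pi * \<bar>?l ^ N * (t - freq n p A)\<bar> * ?l \<le> 1"
        by (simp add: mult_ac)
      then show "7 / 15 \<le> bernoulli_ft ?l (?l ^ N * (t - freq n p A))"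
        using n by (intro bernoulli_ft_lower_bound) auto
    qed
  qed
qed

text \<open>The hypothesis \<open>bessel\<close> makes the increasing partial sums converge to some
  \<open>e\<close> \<le> 1. For the converse, the exact sum 1 of \<open>sum_cos_prod_squared\<close>
  is cut at \<open>m\<close>: the head converges termwise, and the tail is dominated by a multiple
  of the tail of the limit series.\<close>

lemma bernoulli_parseval:
  fixes t :: real
  assumes n: "n \<ge> 2" and p: "odd p" and bound: "real p < 2 * (2 * real n - 1) / pi"
    and bessel: "\<And>N. (\<Sum>A\<in>Pow {..<N}. (bernoulli_ft (1 / (2 * real n)) (t - freq n p A))\<^sup>2) \<le> 1"
  shows "(\<lambda>N. \<Sum>A\<in>Pow {..<N}. (bernoulli_ft (1 / (2 * real n)) (t - freq n p A))\<^sup>2) \<longlonglongrightarrow> 1"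
proof -
  let ?l = "1 / (2 * real n)"
  have l: "\<bar>?l\<bar> < 1" using n by simp
  define F where "F A = (bernoulli_ft ?l (t - freq n p A))\<^sup>2" for A
  define f where "f N A = (cos_prod ?l N (t - freq n p A))\<^sup>2" for N A
  define E where "E N = (\<Sum>A\<in>Pow {..<N}. F A)" for N
  have E1: "E N \<le> 1" for N using bessel by (simp add: E_def F_def)
  have "incseq E"
    unfolding E_def by (intro monoI sum_mono2) (auto simp: F_def)
  then obtain e where e: "E \<longlonglongrightarrow> e"
    using incseq_convergent[of E 1] E1 by blast
  have f_lim: "(\<lambda>N. f N A) \<longlonglongrightarrow> F A" for A
    unfolding f_def F_def by (intro tendsto_intros tendsto_cos_prod l)
  \<comment> \<open>With \<open>m\<close> fixed, \<open>N\<close> tends to infinity first. The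
    remainder, a multiple of \<open>e - E m\<close>, vanishes when \<open>m\<close> tends to
    infinity afterwards.\<close>
  have head: "1 \<le> E m + (15 / 7)\<^sup>2 * (e - E m)" for m
  proof (rule LIMSEQ_le[OF tendsto_const])
    show "(\<lambda>N. (\<Sum>A\<in>Pow {..<m}. f N A) + (15 / 7)\<^sup>2 * (E N - E m)) \<longlonglongrightarrow> E m + (15 / 7)\<^sup>2 * (e - E m)"
      unfolding E_def[of m] by (intro tendsto_intros f_lim e)
    have "eventually (\<lambda>N. 1 \<le> (\<Sum>A\<in>Pow {..<m}. f N A) + (15 / 7)\<^sup>2 * (E N - E m)) sequentially"
      using bernoulli_ft_freq_tail_bound[OF n bound, of t] eventually_ge_at_top[of m]
    proof eventually_elim
      case (elim N)
      have sub: "Pow {..<m} \<subseteq> Pow {..<N}" using elim(2) by auto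
      have "f N A \<le> (15 / 7)\<^sup>2 * F A" if "A \<in> Pow {..<N}" for A
      proof -
        let ?b = "bernoulli_ft ?l (?l ^ N * (t - freq n p A))"
        \<comment> \<open>The lower bound 7/15 on the remaining factor is the source of the constant
          \<open>(15 / 7)^2\<close>.\<close>
        have "(7 / 15)\<^sup>2 \<le> ?b\<^sup>2"
          using elim(1) that by (intro power_mono) auto
        then have "f N A * (7 / 15)\<^sup>2 \<le> f N A * ?b\<^sup>2"
          by (intro mult_left_mono) (auto simp: f_def)
        also have "\<dots> = F A"
          unfolding f_def F_def using bernoulli_ft_split[OF l, of "t - freq n p A" N]
          by (simp add: power_mult_distrib)
        finally show ?thesis by (simp add: field_simps)
      qed
      then have "(\<Sum>A\<in>Pow {..<N} - Pow {..<m}. f N A) \<le> (\<Sum>A\<in>Pow {..<N} - Pow {..<m}. (15 / 7)\<^sup>2 * F A)"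
        by (intro sum_mono) auto
      also have "\<dots> = (15 / 7)\<^sup>2 * (E N - E m)"
        using sub by (simp add: E_def sum_diff sum_distrib_left[symmetric])
      finally have "(\<Sum>A\<in>Pow {..<N} - Pow {..<m}. f N A) \<le> (15 / 7)\<^sup>2 * (E N - E m)" .
      moreover have "1 = (\<Sum>A\<in>Pow {..<N}. f N A)"
        using sum_cos_prod_squared[of n p N t] n p by (simp add: f_def)
      moreover have "(\<Sum>A\<in>Pow {..<N} - Pow {..<m}. f N A) = (\<Sum>A\<in>Pow {..<N}. f N A) - (\<Sum>A\<in>Pow {..<m}. f N A)"
        using sub by (intro sum_diff) auto
      ultimately show ?case by linarith
    qed
    then show "\<exists>N0. \<forall>N\<ge>N0. 1 \<le> (\<Sum>A\<in>Pow {..<m}. f N A) + (15 / 7)\<^sup>2 * (E N - E m)"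
      by (simp add: eventually_sequentially)
  qed
  have "1 \<le> e + (15 / 7)\<^sup>2 * (e - e)"
    by (rule LIMSEQ_le[OF tendsto_const[of 1] tendsto_add[OF e tendsto_mult[OF tendsto_const[of "(15 / 7)\<^sup>2"] tendsto_diff[OF tendsto_const[of e] e]]]])
       (use head in blast)
  moreover have "e \<le> 1" using LIMSEQ_le_const2[OF e] E1 by blast
  ultimately have "e = 1" by simp
  with e show ?thesis by (simp add: E_def[abs_def] F_def)
qed

section \<open>Assembly of the spectral pair\<close>

lemma L2_inner_expo:
  "\<bar>l\<bar> < 1 \<Longrightarrow> L2_inner (bernoulli_measure l) (expo s) (expo t) = of_real (bernoulli_ft l (s - t))"
  by (simp add: L2_inner_def expo_mult_cnj integral_bernoulli_expo)

lemma bernoulli_ft_zero [simp]: "bernoulli_ft l 0 = 1"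
  by (simp add: bernoulli_ft_def cos_prod_def)

lemma expo_L2: "expo s \<in> L2 (bernoulli_measure l)"
proof -
  interpret prob_space "bernoulli_measure l" by (rule prob_space_bernoulli_measure)
  show ?thesis
    by (rule L2_bounded[where C=1]) (auto simp: measurable_cong_sets[OF sets_bernoulli_measure refl])
qed

theorem theoremB:
  fixes n p :: nat
  assumes "n > 0" and "p > 0" and "odd p"
    and "real p < 2 * (2 * real n - 1) / pi"
  shows "spectral_pair (bernoulli_measure (1 / (2 * real n)))
           ((\<lambda>\<gamma>. real p * \<gamma>) ` Gamma_set n)"
proof -
  let ?l = "1 / (2 * real n)"
  let ?M = "bernoulli_measure ?l" and ?e = "\<lambda>A. expo (freq n p A)"
  let ?B = "?e ` {A. finite A}"
  \<comment> \<open>For \<open>n = 1\<close> the bound would give p < 2/pi < 1.\<close>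
  have n: "n \<ge> 2"
  proof (rule ccontr)
    assume "\<not> n \<ge> 2"
    then have "n = 1" using \<open>n > 0\<close> by simp
    then have "real p * pi < 2" using assms(4) by (simp add: field_simps)
    moreover have "1 * 2 \<le> real p * pi"
      using \<open>p > 0\<close> pi_ge_two by (intro mult_mono) auto
    ultimately show False by simp
  qed
  then have l: "\<bar>?l\<bar> < 1" by simp
  interpret prob_space ?M by (rule prob_space_bernoulli_measure)
  have BL2: "?B \<subseteq> L2 ?M" by (auto intro: expo_L2)
  have inner: "L2_inner ?M (?e A) (?e B) = (if A = B then 1 else 0)" if "finite A" "finite B" for A B
    using bernoulli_ft_freq_diff[OF \<open>n > 0\<close> \<open>odd p\<close> that] l by (simp add: L2_inner_expo)
  \<comment> \<open>Equal exponentials for different sets would have inner product 1 and 0 at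
    once.\<close>
  then have inj: "inj_on ?e {A. finite A}"
    by (intro inj_onI) (metis mem_Collect_eq zero_neq_one)
  have on: "orthonormal_L2 ?M ?B"
    unfolding orthonormal_L2_def
  proof (intro conjI ballI BL2)
    fix f g assume "f \<in> ?B" "g \<in> ?B"
    then obtain A B where "finite A" "f = ?e A" "finite B" "g = ?e B" by blast
    then show "L2_inner ?M f g = (if f = g then 1 else 0)"
      using inner[of A B] inj_on_eq_iff[OF inj, of A B] by simp
  qed
  have expo_span: "expo t \<in> L2_closed_span ?M ?B" for t
  proof -
    \<comment> \<open>The squared distance of \<open>expo t\<close> from its projection onto the
      span of the exponentials with digits below position \<open>N\<close>.\<close>
    let ?D = "\<lambda>N. LINT x|?M. (norm (expo t x - (\<Sum>g\<in>?e ` Pow {..<N}. L2_inner ?M (expo t) g * g x)))\<^sup>2"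
    have fin: "finite A" if "A \<in> Pow {..<N}" for A :: "nat set" and N
      using that finite_subset by blast
    then have sub: "?e ` Pow {..<N} \<subseteq> ?B" for N by blast
    have D: "?D N = 1 - (\<Sum>A\<in>Pow {..<N}. (bernoulli_ft ?l (t - freq n p A))\<^sup>2)" for N
    proof -
      have "?D N = (LINT x|?M. (norm (expo t x))\<^sup>2) - (\<Sum>g\<in>?e ` Pow {..<N}. (norm (L2_inner ?M (expo t) g))\<^sup>2)"
        by (intro orthonormal_L2_distance[OF orthonormal_L2_subset[OF on sub]] expo_L2) auto
      also have "(LINT x|?M. (norm (expo t x))\<^sup>2) = 1"
        using prob_space by simp
      also have "(\<Sum>g\<in>?e ` Pow {..<N}. (norm (L2_inner ?M (expo t) g))\<^sup>2)
          = (\<Sum>A\<in>Pow {..<N}. (bernoulli_ft ?l (t - freq n p A))\<^sup>2)"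
        using inj_on_subset[OF inj, of "Pow {..<N}"] fin l
        by (subst sum.reindex) (auto simp: L2_inner_expo)
      finally show ?thesis .
    qed
    \<comment> \<open>Nonnegativity of the distance is Bessel's inequality, the premise of
      \<open>bernoulli_parseval\<close>.\<close>
    have "0 \<le> ?D N" for N by (rule integral_nonneg_AE) auto
    then have "(\<Sum>A\<in>Pow {..<N}. (bernoulli_ft ?l (t - freq n p A))\<^sup>2) \<le> 1" for N
      unfolding D by simp
    then have "?D \<longlonglongrightarrow> 1 - 1"
      unfolding D by (intro tendsto_diff tendsto_const bernoulli_parseval n \<open>odd p\<close> assms(4))
    then have "eventually (\<lambda>N. ?D N < \<epsilon>) sequentially" if "\<epsilon> > 0" for \<epsilon>
      using that by (intro order_tendstoD(2)) auto
    then have small: "\<exists>N. ?D N < \<epsilon>" if "\<epsilon> > 0" for \<epsilon>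
      using that eventually_happens'[OF sequentially_bot] by blast
    have "\<exists>F c. finite F \<and> F \<subseteq> ?B \<and>
        (LINT x|?M. (norm (expo t x - (\<Sum>g\<in>F. c g * g x)))\<^sup>2) < \<epsilon>" if "\<epsilon> > 0" for \<epsilon>
    proof -
      obtain N where "?D N < \<epsilon>" using small[OF \<open>\<epsilon> > 0\<close>] by blast
      then show ?thesis
        using sub by (intro exI[of _ "?e ` Pow {..<N}"] exI[of _ "L2_inner ?M (expo t)"]) simp
    qed
    then show ?thesis
      using expo_L2 by (simp add: L2_closed_span_def)
  qed
  have span: "L2_closed_span ?M ?B = L2 ?M"
    using n by (intro L2_eq_expo_span finite_measure_axioms AE_bernoulli_measure_bounded BL2 expo_span) auto
  have "\<exists>F c. finite F \<and> F \<subseteq> ?B \<and> L2_norm ?M (\<lambda>x. f x - (\<Sum>g\<in>F. c g * g x)) < \<epsilon>"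
    if "f \<in> L2 ?M" "\<epsilon> > 0" for f \<epsilon>
  proof -
    \<comment> \<open>\<open>L2_closed_span\<close> measures the mean-square error and
      \<open>L2_norm\<close> its root, so the tolerance is squared.\<close>
    have "f \<in> L2_closed_span ?M ?B" "\<epsilon>\<^sup>2 > 0" using that span by simp_all
    then obtain F c where F: "finite F" "F \<subseteq> ?B" "(LINT x|?M. (norm (f x - (\<Sum>g\<in>F. c g * g x)))\<^sup>2) < \<epsilon>\<^sup>2"
      by (rule L2_closed_spanD)
    then have "L2_norm ?M (\<lambda>x. f x - (\<Sum>g\<in>F. c g * g x)) < \<epsilon>"
      unfolding L2_norm_def using \<open>\<epsilon> > 0\<close> by (intro real_less_lsqrt) auto
    then show ?thesis using F(1,2) by blast
  qed
  then show ?thesis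
    using on unfolding spectral_pair_def orthonormal_basis_L2_def Gamma_set_eq[OF \<open>n > 0\<close>] image_image
    by blast
qed

end
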